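(* Let $E$ be a Banach space, $\Lambda\subset E$ an open set, $\mathcal F=\{M(x)\}_{x\in\Lambda}$ a family of linear subspaces of $E$ (possibly infinite dimensional), $x_0\in\Lambda$, and $M_0=M(x_0)$. Then $\mathcal F$ is $C^1$ integrable at $x_0$ if and only if the following conditions hold: (i) $M_0$ splits in $E$, say $E=M_0\oplus E_*$; (ii) there exist a neighborhood $V$ of $P^{E_*}_{M_0}x_0$ in $M_0$ and a $C^1$ map $\psi:V\to E_*$ such that $x+\psi(x)\in J(x_0,E_* )$ for all $x\in V$, and $x\mapsto\alpha(x+\psi(x))\in B(M_0,E_* )$ is continuous in $V$; (iii) $\psi$ satisfies $$\psi'(x)=\alpha(x+\psi(x))\quad\text{for all }x\in V,\qquad \psi(P^{E_*}_{M_0}x_0)=P^{M_0}_{E_*}x_0,$$ where $\psi'(x)$ is the Fréchet derivative of $\psi$ at $x$. (That is, $\mathcal F$ is $C^1$ integrable at $x_0$ if and only if there exist $E_*$, $V$ and $\psi$ with these properties.)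
   Context: $\oplus$ denotes a topological direct sum of closed subspaces. For $E=E_1\oplus E_2$, $P^{E_2}_{E_1}$ is the projection of $E$ onto $E_1$ along $E_2$. $B(M_0,E_* )$ is the space of bounded linear operators from $M_0$ to $E_*$. Integrability: $\mathcal F$ is $C^1$ integrable at $x_0$ if there exist a neighborhood $U_0$ of $x_0$ and a $C^1$ submanifold $S$ in $U_0$ (with $S\subset\Lambda$) such that $x_0\in S$ and, for every $x\in S$, $M(x)=\{\dot c(0): c(t)\subset S \text{ a } C^1\text{-curve with } c(0)=x\}$ (i.e. $S$ is tangent to $M(x)$ at each $x\in S$). Here a $C^1$ submanifold $S$ of $E$ is a subset such that around each of its points there are an open neighborhood $W$ in $E$, a splitting $E=E_0\oplus E_1$, and a $C^1$ diffeomorphism $\varphi:W\to\varphi(W)$ onto an open subset of $E$ such that $\varphi(S\cap W)$ is an open subset of $E_0$. Co-final set: if $E=M(x_0)\oplus E_*$, then $J(x_0,E_* )=\{x\in\Lambda: M(x)\oplus E_*=E\}$. The operator $\alpha$: for each $x\in J(x_0,E_* )$, both $M_0$ and $M(x)$ are closed complements of $E_*$, and $\alpha(x)\in B(M_0,E_* )$ denotes the unique operator with $M(x)=\{e+\alpha(x)e: e\in M_0\}$. *)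

theory Defs
  imports "HOL-Analysis.Analysis"
begin

definition proj_along :: "'a::real_normed_vector set \<Rightarrow> 'a set \<Rightarrow> 'a \<Rightarrow> 'a" where
  "proj_along E1 E2 x = (THE u. u \<in> E1 \<and> x - u \<in> E2)"

text \<open>
  The whole space is the topological direct sum of \<open>E1\<close> and \<open>E2\<close>. Continuity of the projection is
  what makes the algebraic sum topological; for closed subspaces of a Banach space it is automatic.
\<close>

definition top_direct_sum :: "'a::real_normed_vector set \<Rightarrow> 'a set \<Rightarrow> bool" where
  "top_direct_sum E1 E2 \<longleftrightarrow>
     subspace E1 \<and> closed E1 \<and> subspace E2 \<and> closed E2 \<and>
     E1 \<inter> E2 = {0} \<and> (\<forall>x. \<exists>u\<in>E1. \<exists>v\<in>E2. x = u + v) \<and>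
     bounded_linear (proj_along E1 E2)"

text \<open>
  \<open>B(X, Y)\<close> for subspaces \<open>X\<close>, \<open>Y\<close>: since these are sets and not types, an operator is represented by a
  function on the ambient space that is \<^const>\<open>undefined\<close> outside \<open>X\<close>, so that equality of
  functions is equality of operators.
\<close>

definition operators :: "'a::real_normed_vector set \<Rightarrow> 'a set \<Rightarrow> ('a \<Rightarrow> 'a) set" where
  "operators X Y =
     {T \<in> X \<rightarrow>\<^sub>E Y.
        (\<forall>u\<in>X. \<forall>v\<in>X. T (u + v) = T u + T v) \<and>
        (\<forall>r. \<forall>u\<in>X. T (r *\<^sub>R u) = r *\<^sub>R T u) \<and>
        (\<exists>K. \<forall>u\<in>X. norm (T u) \<le> K * norm u)}"

definition operator_norm_on :: "'a::real_normed_vector set \<Rightarrow> ('a \<Rightarrow> 'a) \<Rightarrow> real" where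
  "operator_norm_on X T = (SUP u\<in>X. norm (T u) / norm u)"

definition operator_continuous_on ::
    "'a::real_normed_vector set \<Rightarrow> 'a set \<Rightarrow> ('a \<Rightarrow> 'a \<Rightarrow> 'a) \<Rightarrow> bool" where
  "operator_continuous_on X V A \<longleftrightarrow>
     (\<forall>x\<in>V. ((\<lambda>y. operator_norm_on X (\<lambda>h. A y h - A x h)) \<longlongrightarrow> 0) (at x within V))"

text \<open>
  \<open>T \<in> B(X, Y)\<close> is the Frechet derivative at \<open>x\<close> of \<open>f : V \<rightarrow> Y\<close>, where \<open>V\<close> is meant to be open in
  the subspace \<open>X\<close>; increments are then taken in \<open>X\<close> only.
\<close>

definition has_derivative_between ::
    "'a::real_normed_vector set \<Rightarrow> 'a set \<Rightarrow> 'a set \<Rightarrow> ('a \<Rightarrow> 'a) \<Rightarrow> ('a \<Rightarrow> 'a) \<Rightarrow> 'a \<Rightarrow> bool" where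
  "has_derivative_between X Y V f T x \<longleftrightarrow>
     T \<in> operators X Y \<and>
     ((\<lambda>y. norm (f y - f x - T (y - x)) / norm (y - x)) \<longlongrightarrow> 0) (at x within V)"

definition C1_between ::
    "'a::real_normed_vector set \<Rightarrow> 'a set \<Rightarrow> 'a set \<Rightarrow> ('a \<Rightarrow> 'a) \<Rightarrow> bool" where
  "C1_between X Y V f \<longleftrightarrow>
     f \<in> V \<rightarrow> Y \<and>
     (\<exists>D. (\<forall>x\<in>V. has_derivative_between X Y V f (D x) x) \<and> operator_continuous_on X V D)"

definition C1_on :: "'a::real_normed_vector set \<Rightarrow> ('a \<Rightarrow> 'b::real_normed_vector) \<Rightarrow> bool" where
  "C1_on W f \<longleftrightarrow>
     (\<exists>f' :: 'a \<Rightarrow> 'a \<Rightarrow>\<^sub>L 'b.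
        (\<forall>x\<in>W. (f has_derivative blinfun_apply (f' x)) (at x)) \<and> continuous_on W f')"

definition C1_diffeomorphism_on ::
    "'a::real_normed_vector set \<Rightarrow> ('a \<Rightarrow> 'b::real_normed_vector) \<Rightarrow> bool" where
  "C1_diffeomorphism_on W \<phi> \<longleftrightarrow>
     open W \<and> open (\<phi> ` W) \<and> inj_on \<phi> W \<and> C1_on W \<phi> \<and> C1_on (\<phi> ` W) (inv_into W \<phi>)"

definition C1_submanifold :: "'a::real_normed_vector set \<Rightarrow> bool" where
  "C1_submanifold S \<longleftrightarrow>
     (\<forall>x\<in>S. \<exists>W E0 E1. \<exists>\<phi> :: 'a \<Rightarrow> 'a.
        x \<in> W \<and> top_direct_sum E0 E1 \<and> C1_diffeomorphism_on W \<phi> \<and>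
        openin (top_of_set E0) (\<phi> ` (S \<inter> W)))"

definition tangent_vectors :: "'a::real_normed_vector set \<Rightarrow> 'a \<Rightarrow> 'a set" where
  "tangent_vectors S x =
     {v. \<exists>\<epsilon>>0. \<exists>c :: real \<Rightarrow> 'a.
           c C1_differentiable_on {-\<epsilon><..<\<epsilon>} \<and> c ` {-\<epsilon><..<\<epsilon>} \<subseteq> S \<and>
           c 0 = x \<and> (c has_vector_derivative v) (at 0)}"

definition C1_integrable_at :: "'a::real_normed_vector set \<Rightarrow> ('a \<Rightarrow> 'a set) \<Rightarrow> 'a \<Rightarrow> bool" where
  "C1_integrable_at \<Lambda> M x0 \<longleftrightarrow>
     (\<exists>U0 S. open U0 \<and> x0 \<in> U0 \<and> C1_submanifold S \<and> S \<subseteq> U0 \<and> S \<subseteq> \<Lambda> \<and> x0 \<in> S \<and>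
        (\<forall>x\<in>S. M x = tangent_vectors S x))"

definition cofinal_set :: "'a::real_normed_vector set \<Rightarrow> ('a \<Rightarrow> 'a set) \<Rightarrow> 'a set \<Rightarrow> 'a set" where
  "cofinal_set \<Lambda> M Es = {x \<in> \<Lambda>. top_direct_sum (M x) Es}"

definition graph_operator ::
    "('a::real_normed_vector \<Rightarrow> 'a set) \<Rightarrow> 'a set \<Rightarrow> 'a set \<Rightarrow> 'a \<Rightarrow> 'a \<Rightarrow> 'a" where
  "graph_operator M M0 Es x = (THE T. T \<in> operators M0 Es \<and> M x = {e + T e | e. e \<in> M0})"

lemma proj_along_props:
  assumes "top_direct_sum E1 E2"
  shows "proj_along E1 E2 x \<in> E1 \<and> x - proj_along E1 E2 x \<in> E2"
proof -
  obtain u v where uv: "u \<in> E1" "v \<in> E2" "x = u + v"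
    using assms unfolding top_direct_sum_def by blast
  have "w = u" if "w \<in> E1 \<and> x - w \<in> E2" for w
  proof -
    have "x - u \<in> E2" using uv by simp
    then have "w - u \<in> E1" "(x - u) - (x - w) \<in> E2"
      using that uv assms unfolding top_direct_sum_def by (blast intro: subspace_diff)+
    then have "w - u \<in> E1 \<inter> E2" by simp
    then show ?thesis using assms unfolding top_direct_sum_def by simp
  qed
  then have "\<exists>!w. w \<in> E1 \<and> x - w \<in> E2" using uv by (intro ex1I[of _ u]) auto
  then show ?thesis unfolding proj_along_def by (rule theI')
qed

text \<open>The definite description in \<^const>\<open>graph_operator\<close> is justified on the co-final set.\<close>

lemma graph_operator_ex1:
  assumes 0: "top_direct_sum M0 Es" and 1: "top_direct_sum (M x) Es"
  shows "\<exists>!T. T \<in> operators M0 Es \<and> M x = {e + T e | e. e \<in> M0}"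
proof -
  define P where "P = proj_along (M x) Es"
  define Q where "Q = proj_along M0 Es"
  define T where "T = restrict (\<lambda>e. P e - e) M0"
  note s = 0[unfolded top_direct_sum_def] 1[unfolded top_direct_sum_def]
  have P: "P y \<in> M x" "y - P y \<in> Es" and Q: "Q y \<in> M0" "y - Q y \<in> Es" for y
    using proj_along_props[OF 0, of y] proj_along_props[OF 1, of y] by (auto simp: P_def Q_def)
  have P': "P y - y \<in> Es" for y using P(2)[of y] s subspace_neg[of Es "y - P y"] by simp
  have bl: "bounded_linear (\<lambda>e. P e - e)"
    using s unfolding P_def by (intro bounded_linear_sub bounded_linear_ident) auto
  then obtain K where K: "\<And>e. norm (P e - e) \<le> norm e * K" using bounded_linear.bounded by blast
  have "T \<in> operators M0 Es"
    unfolding operators_def T_def using s P' K linear_add[OF bounded_linear.linear[OF bl]]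
      linear_scale[OF bounded_linear.linear[OF bl]]
    by (auto simp: subspace_add subspace_scale mult.commute intro!: exI[of _ K])
  moreover have "M x = {e + T e | e. e \<in> M0}"
  proof (intro equalityI subsetI)
    fix m assume m: "m \<in> M x"
    have "P (Q m) - m \<in> M x" using m P s by (auto intro: subspace_diff)
    moreover have "(P (Q m) - Q m) - (m - Q m) \<in> Es" using P' Q s by (blast intro: subspace_diff)
    ultimately have "P (Q m) - m \<in> M x \<inter> Es" by simp
    then have "P (Q m) = m" using s by simp
    then show "m \<in> {e + T e | e. e \<in> M0}" using Q(1)[of m] by (force simp: T_def)
  qed (auto simp: T_def P)
  moreover have "T1 = T2"
    if 1: "T1 \<in> operators M0 Es" "M x = {e + T1 e | e. e \<in> M0}"
      and 2: "T2 \<in> operators M0 Es" "M x = {e + T2 e | e. e \<in> M0}" for T1 T2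
  proof (rule extensionalityI[of _ M0])
    show "T1 \<in> extensional M0" "T2 \<in> extensional M0" using 1 2 by (auto simp: operators_def PiE_def)
    fix e assume e: "e \<in> M0"
    then have "e + T1 e \<in> {e + T2 e | e. e \<in> M0}" using 1 2 by blast
    then obtain d where d: "d \<in> M0" "e + T1 e = d + T2 d" by auto
    have *: "T1 e \<in> Es" "T2 d \<in> Es" using e d 1 2 by (auto simp: operators_def)
    have eq: "e - d = T2 d - T1 e" using d(2) by (simp add: algebra_simps)
    have "e - d \<in> M0" "T2 d - T1 e \<in> Es" using e d * s by (auto intro: subspace_diff)
    then have "e - d \<in> M0 \<inter> Es" using eq by simp
    then have "e = d" using s by simp
    then show "T1 e = T2 e" using d(2) by simp
  qed
  ultimately show ?thesis by blast
qed

end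

theory Submission
  imports Defs
begin

text \<open>
  If \<open>\<psi>\<close> is given, its graph \<open>S\<close> is flattened by the global chart \<open>w \<mapsto> w - \<psi> (P w)\<close>, where \<open>P\<close> is the
  projection onto \<open>M x0\<close>; its tangent space is the graph of \<open>\<psi>'\<close>, which is \<open>M\<close> by assumption.

  Conversely, a chart \<open>\<phi>\<close> of \<open>S\<close> at \<open>x0\<close> with derivative \<open>K\<close> and model \<open>E0 \<oplus> E1\<close> gives
  \<open>M x0 = K\<^sup>-\<^sup>1 E0\<close>, complemented by \<open>K\<^sup>-\<^sup>1 E1\<close>. With \<open>Q\<close> the projection onto \<open>E0\<close>, the modified chart
  \<open>H w = P w + K\<^sup>-\<^sup>1 (\<phi> w - Q (\<phi> w))\<close> has derivative \<open>id\<close> at \<open>x0\<close>, maps \<open>S\<close> into \<open>M x0\<close> and satisfies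
  \<open>P \<circ> H = P\<close>. Its local inverse \<open>G\<close> therefore moves points only along the complement, and
  \<open>\<psi> y = G y - y\<close> on \<open>M x0\<close> parametrizes \<open>S\<close> as a graph.
\<close>

section \<open>The local inverse of a \<open>C\<^sup>1\<close> map\<close>

lemma C1_onI:
  assumes "\<And>x. x \<in> W \<Longrightarrow> (f has_derivative blinfun_apply (f' x)) (at x)" "continuous_on W f'"
  shows "C1_on W f"
  using assms unfolding C1_on_def by blast

lemma C1_on_subset: "C1_on W f \<Longrightarrow> V \<subseteq> W \<Longrightarrow> C1_on V f"
  unfolding C1_on_def using continuous_on_subset by blast

lemma C1_on_continuous_on: "C1_on W f \<Longrightarrow> continuous_on W f"
  unfolding C1_on_def
  by (meson continuous_at_imp_continuous_on has_derivative_continuous)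

lemma C1_on_blinfun: "C1_on W (blinfun_apply A)"
  by (rule C1_onI[where f' = "\<lambda>_. A"])
     (auto intro: bounded_linear_imp_has_derivative blinfun.bounded_linear_right)

lemma C1_on_add:
  assumes "C1_on W f" "C1_on W g"
  shows "C1_on W (\<lambda>x. f x + g x)"
proof -
  obtain f' g' where "\<forall>x\<in>W. (f has_derivative blinfun_apply (f' x)) (at x)" "continuous_on W f'"
    "\<forall>x\<in>W. (g has_derivative blinfun_apply (g' x)) (at x)" "continuous_on W g'"
    using assms unfolding C1_on_def by blast
  then show ?thesis
    by (intro C1_onI[where f' = "\<lambda>x. f' x + g' x"])
       (auto simp: plus_blinfun.rep_eq intro!: has_derivative_add continuous_on_add)
qed

lemma C1_on_blinfun_comp:
  assumes "C1_on W f"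
  shows "C1_on W (\<lambda>x. blinfun_apply A (f x))"
proof -
  obtain f' where "\<forall>x\<in>W. (f has_derivative blinfun_apply (f' x)) (at x)" "continuous_on W f'"
    using assms unfolding C1_on_def by blast
  then show ?thesis
    by (intro C1_onI[where f' = "\<lambda>x. A o\<^sub>L f' x"])
       (auto intro!: continuous_intros bounded_linear.has_derivative[OF blinfun.bounded_linear_right]
             simp: blinfun_compose.rep_eq o_def)
qed

lemma C1_on_diff:
  assumes "C1_on W f" "C1_on W g"
  shows "C1_on W (\<lambda>x. f x - g x)"
  using C1_on_add[OF assms(1) C1_on_blinfun_comp[OF assms(2), of "- id_blinfun"]]
  by (simp add: blinfun.minus_left)

section \<open>Inversion near the identity by contractions with factor 1/2\<close>

lemma half_contraction_fixpoint:
  fixes f :: "'a::banach \<Rightarrow> 'a"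
  assumes "closed S" "S \<noteq> {}" "f ` S \<subseteq> S"
    and "\<And>x y. x \<in> S \<Longrightarrow> y \<in> S \<Longrightarrow> norm (f x - f y) \<le> norm (x - y) / 2"
  obtains x where "x \<in> S" "f x = x"
  using Banach_fix[of S "1/2" f] assms complete_eq_closed[of S] by (auto simp: dist_norm)

text \<open>The inverse is found as a fixed point of \<open>h \<mapsto> y - (A h - h)\<close>, so no Neumann series is needed.\<close>

lemma blinfun_near_id_inverse:
  fixes A :: "'a::banach \<Rightarrow>\<^sub>L 'a"
  assumes "norm (A - id_blinfun) \<le> 1/2"
  obtains B where "A o\<^sub>L B = id_blinfun" "B o\<^sub>L A = id_blinfun" "norm B \<le> 2"
proof -
  have R: "norm (A h - h) \<le> norm h / 2" for h
    using order_trans[OF norm_blinfun[of "A - id_blinfun" h] mult_right_mono[OF assms norm_ge_zero]]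
    by (simp add: blinfun.diff_left)
  \<comment> \<open>Write \<open>h\<close> as \<open>A h + (h - A h)\<close>; the second term has at
    most half the norm of \<open>h\<close>. This bound yields injectivity and also the norm bound 2
    for the inverse.\<close>
  have low: "norm h \<le> 2 * norm (A h)" for h
    using R[of h] norm_triangle_ineq2[of h "h - A h"] by (simp add: norm_minus_commute)
  have inj: "h = k" if "A h = A k" for h k
    using low[of "h - k"] that by (simp add: blinfun.diff_right)
  have ex: "\<exists>h. A h = y" for y
  proof -
    have "norm ((y - (A h - h)) - (y - (A k - k))) \<le> norm (h - k) / 2" for h k
      using R[of "k - h"] by (simp add: blinfun.diff_right algebra_simps norm_minus_commute)
    then obtain h where "y - (A h - h) = h"
      using half_contraction_fixpoint[of UNIV "\<lambda>h. y - (A h - h)"] by auto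
    then show ?thesis by (intro exI[of _ h]) (simp add: algebra_simps)
  qed
  define b where "b = inv (blinfun_apply A)"
  have Ab: "A (b y) = y" for y unfolding b_def using ex by (metis f_inv_into_f rangeI)
  have bA: "b (A h) = h" for h using inj Ab by blast
  have "bounded_linear b"
  proof (rule bounded_linear_intro[where K = 2])
    show "b (x + y) = b x + b y" for x y by (rule inj) (simp add: Ab blinfun.add_right)
    show "b (r *\<^sub>R x) = r *\<^sub>R b x" for r x by (rule inj) (simp add: Ab blinfun.scaleR_right)
    show "norm (b x) \<le> norm x * 2" for x using low[of "b x"] by (simp add: Ab)
  qed
  then have B: "blinfun_apply (Blinfun b) = b" by (rule bounded_linear_Blinfun_apply)
  show thesis
  proof
    show "A o\<^sub>L Blinfun b = id_blinfun" "Blinfun b o\<^sub>L A = id_blinfun"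
      by (auto intro!: blinfun_eqI simp: B Ab bA)
    show "norm (Blinfun b) \<le> 2"
      using low[of "b x" for x] by (intro norm_blinfun_bound) (auto simp: B Ab)
  qed
qed

text \<open>Inverse function theorem, normalized to derivative \<open>id\<close> at
  \<open>x0\<close>. On a small ball \<open>f\<close> is the identity plus a map \<open>R\<close>
  with Lipschitz constant 1/2, which makes \<open>f\<close> injective and open with a Lipschitz
  inverse.\<close>

lemma C1_local_inverse_at_id:
  fixes f :: "'a::banach \<Rightarrow> 'a"
  assumes W: "open W" "x0 \<in> W" and f: "C1_on W f" and id: "(f has_derivative (\<lambda>h. h)) (at x0)"
  obtains U where "open U" "x0 \<in> U" "U \<subseteq> W" "C1_diffeomorphism_on U f"
proof -
  obtain f' :: "'a \<Rightarrow> 'a \<Rightarrow>\<^sub>L 'a" where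
    f': "\<And>x. x \<in> W \<Longrightarrow> (f has_derivative blinfun_apply (f' x)) (at x)" and cont: "continuous_on W f'"
    using f unfolding C1_on_def by blast
  have "f' x0 = id_blinfun"
    using has_derivative_unique[OF f'[OF W(2)] id] by (auto intro: blinfun_eqI)
  then have "\<forall>\<^sub>F x in at x0. dist (f' x) id_blinfun < 1/2"
    using cont W by (metis at_within_open continuous_on_def tendstoD half_gt_zero zero_less_one)
  moreover have "\<forall>\<^sub>F x in at x0. x \<in> W"
    using W by (simp add: eventually_at_in_open')
  ultimately have "\<forall>\<^sub>F x in at x0. x \<in> W \<and> dist (f' x) id_blinfun < 1/2"
    by eventually_elim auto
  then obtain d where d: "d > 0"
    "\<And>x. x \<noteq> x0 \<Longrightarrow> dist x x0 < d \<Longrightarrow> x \<in> W \<and> dist (f' x) id_blinfun < 1/2"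
    unfolding eventually_at by auto
  \<comment> \<open>A ball is convex, as the mean value estimate for \<open>R\<close>
    requires.\<close>
  define U where "U = ball x0 d"
  have U: "open U" "x0 \<in> U" "convex U" unfolding U_def using d by auto
  have near: "x \<in> W \<and> norm (f' x - id_blinfun) \<le> 1/2" if "x \<in> U" for x
    using d(2)[of x] that W \<open>f' x0 = id_blinfun\<close>
    by (cases "x = x0") (auto simp: U_def dist_norm norm_minus_commute)
  then have UW: "U \<subseteq> W" by auto
  define R where "R x = f x - x" for x
  have lip: "norm (R x - R y) \<le> norm (x - y) / 2" if "x \<in> U" "y \<in> U" for x y
  proof -
    have "norm (R x - R y) \<le> 1/2 * norm (x - y)"
    proof (rule differentiable_bound[OF U(3) _ _ that])
      fix z assume z: "z \<in> U"
      show "(R has_derivative blinfun_apply (f' z - id_blinfun)) (at z within U)"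
        using has_derivative_diff[OF has_derivative_at_withinI[OF f'] has_derivative_ident, of z U]
          near[OF z] by (simp add: R_def[abs_def] minus_blinfun.rep_eq)
      show "onorm (blinfun_apply (f' z - id_blinfun)) \<le> 1/2"
        using near[OF z] by (simp add: norm_blinfun.rep_eq)
    qed
    then show ?thesis by simp
  qed
  have low: "norm (x - y) \<le> 2 * norm (f x - f y)" if "x \<in> U" "y \<in> U" for x y
    using lip[OF that] norm_triangle_ineq2[of "x - y" "R y - R x"]
    by (simp add: R_def norm_minus_commute)
  have inj: "inj_on f U"
    using low by (fastforce simp: inj_on_def)
  have opf: "open (f ` U)"
    unfolding open_contains_ball
  proof
    fix v assume "v \<in> f ` U"
    then obtain w where w: "w \<in> U" "v = f w" by blast
    obtain s where s: "s > 0" "cball w s \<subseteq> U"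
      using U w open_contains_cball by blast
    have "y \<in> f ` U" if y: "y \<in> ball v (s/2)" for y
    proof -
      \<comment> \<open>Solving \<open>f z = y\<close> means finding a fixed point of
        \<open>z \<mapsto> y - R z\<close>. On the closed ball of radius \<open>s\<close> the centre
        moves by at most \<open>s/2\<close> and the contraction contributes at most
        \<open>s/2\<close> more, hence the radius \<open>s/2\<close> for \<open>y\<close>.\<close>
      have contr: "norm ((y - R z) - (y - R z')) \<le> norm (z - z') / 2" if "z \<in> cball w s" "z' \<in> cball w s" for z z'
        using lip[of z' z] that s by (auto simp: norm_minus_commute subset_iff)
      have self: "(\<lambda>z. y - R z) ` cball w s \<subseteq> cball w s"
      proof clarify
        fix z assume z: "z \<in> cball w s"
        have "norm (w - (y - R z)) = norm ((f w - y) + (R z - R w))"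
          by (rule arg_cong[where f = norm]) (simp add: R_def algebra_simps)
        also have "\<dots> \<le> norm (f w - y) + norm (R z - R w)" by (rule norm_triangle_ineq)
        also have "\<dots> \<le> s / 2 + norm (z - w) / 2"
          using y w lip[of z w] s z by (intro add_mono) (auto simp: dist_norm subset_iff)
        also have "\<dots> \<le> s" using z by (simp add: dist_norm norm_minus_commute)
        finally show "y - R z \<in> cball w s" by (simp add: dist_norm)
      qed
      obtain z where "z \<in> cball w s" "y - R z = z"
        by (rule half_contraction_fixpoint[OF closed_cball _ self contr]) (use s in auto)
      then show ?thesis using s by (intro image_eqI[of _ _ z]) (auto simp: R_def algebra_simps)
    qed
    then show "\<exists>e>0. ball v e \<subseteq> f ` U" using s by (intro exI[of _ "s/2"]) auto
  qed
  define g where "g = inv_into U f"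
  have gU: "g y \<in> U" and fg: "f (g y) = y" if "y \<in> f ` U" for y
    using that by (auto simp: g_def inv_into_into f_inv_into_f)
  have cg: "continuous_on (f ` U) g"
  proof (rule lipschitz_on_continuous_on[where L = 2], rule lipschitz_onI)
    show "dist (g x) (g y) \<le> 2 * dist x y" if "x \<in> f ` U" "y \<in> f ` U" for x y
      using low[OF gU gU, OF that] that by (simp add: fg dist_norm)
  qed simp
  \<comment> \<open>The inverses of the derivatives are chosen pointwise, so their continuity in
    \<open>x\<close> has to be proved separately.\<close>
  have "\<forall>x. \<exists>B. x \<in> U \<longrightarrow> f' x o\<^sub>L B = id_blinfun \<and> B o\<^sub>L f' x = id_blinfun \<and> norm B \<le> 2"
    using near blinfun_near_id_inverse by metis
  then obtain J where J: "\<And>x. x \<in> U \<Longrightarrow> f' x o\<^sub>L J x = id_blinfun"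
    "\<And>x. x \<in> U \<Longrightarrow> J x o\<^sub>L f' x = id_blinfun" "\<And>x. x \<in> U \<Longrightarrow> norm (J x) \<le> 2"
    by metis
  have Jbound: "norm (J x - J y) \<le> 4 * norm (f' x - f' y)" if "x \<in> U" "y \<in> U" for x y
  proof -
    \<comment> \<open>Resolvent identity: it bounds the variation of the inverses by the variation
      of \<open>f'\<close>.\<close>
    have "J x - J y = J x o\<^sub>L (f' y - f' x) o\<^sub>L J y"
    proof (rule blinfun_eqI)
      fix h
      have "f' y (J y h) = h" "J x (f' x (J y h)) = J y h"
        using J(1)[OF that(2)] J(2)[OF that(1)]
        by (metis blinfun_apply_blinfun_compose blinfun_apply_id_blinfun)+
      then show "(J x - J y) h = (J x o\<^sub>L (f' y - f' x) o\<^sub>L J y) h"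
        by (simp add: blinfun.diff_left blinfun.diff_right)
    qed
    also have "norm \<dots> \<le> norm (J x) * norm (f' y - f' x) * norm (J y)"
      by (rule order_trans[OF norm_blinfun_compose mult_right_mono[OF norm_blinfun_compose]]) simp
    also have "\<dots> \<le> 2 * norm (f' y - f' x) * 2"
      using J(3) that by (intro mult_mono) auto
    finally show ?thesis by (simp add: norm_minus_commute)
  qed
  have cJ: "continuous_on U J"
    unfolding continuous_on_def
  proof
    fix x assume x: "x \<in> U"
    have "((\<lambda>y. 4 * norm (f' y - f' x)) \<longlongrightarrow> 4 * norm (f' x - f' x)) (at x within U)"
      using continuous_on_subset[OF cont UW] x by (intro tendsto_intros) (simp add: continuous_on_def)
    moreover have "\<forall>\<^sub>F y in at x within U. norm (J y - J x) \<le> 4 * norm (f' y - f' x)"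
      using Jbound[OF _ x] by (simp add: eventually_at_filter)
    ultimately have "((\<lambda>y. J y - J x) \<longlongrightarrow> 0) (at x within U)"
      using Lim_null_comparison[of "\<lambda>y. J y - J x" "\<lambda>y. 4 * norm (f' y - f' x)"] by simp
    then show "(J \<longlongrightarrow> J x) (at x within U)" by (simp add: LIM_zero_iff)
  qed
  have "C1_on (f ` U) g"
  proof (rule C1_onI[where f' = "\<lambda>y. J (g y)"])
    show "continuous_on (f ` U) (\<lambda>y. J (g y))"
      using gU by (intro continuous_on_compose2[OF cJ cg]) auto
    fix y assume y: "y \<in> f ` U"
    show "(g has_derivative blinfun_apply (J (g y))) (at y)"
    proof (rule has_derivative_inverse_basic[OF f' _ _ _ opf y])
      show "g y \<in> W" using UW gU y by auto
      show "blinfun_apply (J (g y)) \<circ> blinfun_apply (f' (g y)) = id"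
        using arg_cong[OF J(2)[OF gU[OF y]], of blinfun_apply]
        by (simp add: blinfun_compose.rep_eq id_def)
      show "continuous (at y) g"
        using cg opf y continuous_on_eq_continuous_at by blast
    qed (auto simp: fg blinfun.bounded_linear_right)
  qed
  then have "C1_diffeomorphism_on U f"
    unfolding C1_diffeomorphism_on_def g_def using U opf inj C1_on_subset[OF f UW] by simp
  with U UW show thesis using that by blast
qed

section \<open>Direct sums and tangent spaces\<close>

lemma C1_on_cong:
  assumes "open W" "C1_on W f" "\<And>x. x \<in> W \<Longrightarrow> f x = g x"
  shows "C1_on W g"
  using assms unfolding C1_on_def by (metis has_derivative_transform_within_open)

lemma C1_diffeomorphism_onI:
  assumes "open W" "open (f ` W)" "C1_on W f" "C1_on (f ` W) g" "\<And>w. w \<in> W \<Longrightarrow> g (f w) = w"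
  shows "C1_diffeomorphism_on W f"
proof -
  have inj: "inj_on f W" using assms(5) by (metis inj_onI)
  have "C1_on (f ` W) (inv_into W f)"
    by (rule C1_on_cong[OF assms(2,4)]) (auto simp: assms(5) inv_into_f_f[OF inj])
  then show ?thesis using assms inj by (simp add: C1_diffeomorphism_on_def)
qed

text \<open>Chain rule for \<open>g \<circ> f\<close>, which is the identity near \<open>x\<close>.
  Used for a chart and its inverse in either order, it shows that their derivatives are mutually
  inverse.\<close>

lemma has_derivative_left_inverse:
  assumes "open W" "x \<in> W" "\<And>w. w \<in> W \<Longrightarrow> g (f w) = w"
    and "(f has_derivative f') (at x)" "(g has_derivative g') (at (f x))"
  shows "g' (f' h) = h"
proof -
  have "((\<lambda>w. g (f w)) has_derivative (\<lambda>h. g' (f' h))) (at x)"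
    by (rule has_derivative_compose[OF assms(4,5)])
  then have "((\<lambda>w. w) has_derivative (\<lambda>h. g' (f' h))) (at x)"
    by (rule has_derivative_transform_within_open) (use assms in auto)
  from has_derivative_unique[OF this has_derivative_ident] show ?thesis by meson
qed

lemma proj_along_eqI:
  assumes "subspace X" "subspace Y" "X \<inter> Y = {0}" "u \<in> X" "x - u \<in> Y"
  shows "proj_along X Y x = u"
  unfolding proj_along_def
proof (rule the_equality)
  fix v assume v: "v \<in> X \<and> x - v \<in> Y"
  have "v - u \<in> X" using v assms by (auto intro: subspace_diff)
  moreover have "(x - u) - (x - v) \<in> Y" using v assms(2,5) by (blast intro: subspace_diff)
  ultimately have "v - u \<in> X \<inter> Y" by simp
  then show "v = u" using assms(3) by simp
qed (use assms in auto)

lemma top_direct_sum_projection: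
  assumes "top_direct_sum X Y"
  obtains P :: "'a::real_normed_vector \<Rightarrow>\<^sub>L 'a"
  where "proj_along X Y = blinfun_apply P" "\<And>x. P x \<in> X" "\<And>x. x - P x \<in> Y"
    "\<And>x. x \<in> X \<longleftrightarrow> P x = x" "\<And>x. x \<in> Y \<longleftrightarrow> P x = 0"
    "\<And>x. proj_along Y X x = x - P x"
proof
  note td = assms[unfolded top_direct_sum_def]
  define p where "p = Blinfun (proj_along X Y)"
  have P: "proj_along X Y = blinfun_apply p"
    using td by (simp add: p_def bounded_linear_Blinfun_apply)
  show "proj_along X Y = blinfun_apply p" by (rule P)
  show 1: "p x \<in> X" and 2: "x - p x \<in> Y" for x
    using proj_along_props[OF assms, of x] by (auto simp: P)
  have eq: "p x = u" if "u \<in> X" "x - u \<in> Y" for x u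
    using proj_along_eqI[of X Y u x] that td by (simp add: P)
  show "x \<in> X \<longleftrightarrow> p x = x" for x
    using eq[of x x] 1[of x] td by (metis cancel_comm_monoid_add_class.diff_cancel subspace_0)
  show "x \<in> Y \<longleftrightarrow> p x = 0" for x
    using eq[of 0 x] 2[of x] td by (metis diff_zero subspace_0)
  show "proj_along Y X x = x - p x" for x
    by (rule proj_along_eqI) (use td 1 2 in auto)
qed

text \<open>Fixed space and kernel of a bounded idempotent are closed as solution sets of continuous
  equations, and \<open>P\<close> itself is the projection. Splittings are therefore built by
  exhibiting an idempotent.\<close>

lemma top_direct_sum_idempotent:
  fixes P :: "'a::real_normed_vector \<Rightarrow>\<^sub>L 'a"
  assumes "\<And>x. P (P x) = P x"
  shows "top_direct_sum {x. P x = x} {x. P x = 0}"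
proof -
  have s: "subspace {x. P x = x}" "subspace {x. P x = 0}"
    by (auto simp: subspace_def blinfun.bilinear_simps)
  have c: "closed {x. P x = x}" "closed {x. P x = 0}"
    by (auto intro!: closed_Collect_eq continuous_intros)
  have i: "{x. P x = x} \<inter> {x. P x = 0} = {0}"
    by (auto simp: blinfun.zero_right)
  have "proj_along {x. P x = x} {x. P x = 0} x = P x" for x
    by (rule proj_along_eqI[OF s i]) (auto simp: assms blinfun.diff_right)
  then have "proj_along {x. P x = x} {x. P x = 0} = blinfun_apply P" by (rule ext)
  then have "bounded_linear (proj_along {x. P x = x} {x. P x = 0})"
    by (simp only: blinfun.bounded_linear_right)
  moreover have "\<exists>u\<in>{x. P x = x}. \<exists>v\<in>{x. P x = 0}. x = u + v" for x
    by (rule bexI[of _ "P x"], rule bexI[of _ "x - P x"]) (auto simp: assms blinfun.diff_right)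
  ultimately show ?thesis unfolding top_direct_sum_def using s c i by blast
qed

text \<open>The map \<open>P + A P\<close> is idempotent because \<open>P A P = 0\<close>; its fixed
  space is the graph of \<open>A\<close> over \<open>X\<close> and its kernel is
  \<open>Y\<close>.\<close>

lemma top_direct_sum_graph:
  fixes A :: "'a::real_normed_vector \<Rightarrow>\<^sub>L 'a"
  assumes "top_direct_sum X Y" "\<And>u. u \<in> X \<Longrightarrow> A u \<in> Y"
  shows "top_direct_sum {e + A e | e. e \<in> X} Y"
proof -
  obtain P :: "'a \<Rightarrow>\<^sub>L 'a" where P: "\<And>x. P x \<in> X" "\<And>x. x \<in> X \<longleftrightarrow> P x = x" "\<And>x. x \<in> Y \<longleftrightarrow> P x = 0"
    using top_direct_sum_projection[OF assms(1)] by metis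
  define p where "p = P + (A o\<^sub>L P)"
  have p: "p x = P x + A (P x)" for x by (simp add: p_def blinfun.add_left)
  have PP: "P (P x) = P x" for x using P(1,2) by blast
  have PA: "P (A (P x)) = 0" for x using P(1,3) assms(2) by blast
  have "{x. p x = x} = {e + A e | e. e \<in> X}"
  proof (intro equalityI subsetI)
    fix x assume "x \<in> {x. p x = x}"
    then have "x = P x + A (P x)" by (simp add: p)
    then show "x \<in> {e + A e | e. e \<in> X}" using P(1) by blast
  next
    fix x assume "x \<in> {e + A e | e. e \<in> X}"
    then obtain e where "x = e + A e" "P e = e" using P(2) by blast
    then show "x \<in> {x. p x = x}" using PA[of e] by (simp add: p blinfun.add_right)
  qed
  moreover have "{x. p x = 0} = Y"
  proof (intro equalityI subsetI)
    fix x assume "x \<in> {x. p x = 0}"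
    then have "P (P x + A (P x)) = 0" by (simp add: p blinfun.zero_right)
    then show "x \<in> Y" using P(3) by (simp add: blinfun.add_right PP PA)
  qed (simp add: p P(3) blinfun.zero_right)
  moreover have "top_direct_sum {x. p x = x} {x. p x = 0}"
    by (rule top_direct_sum_idempotent) (simp add: p blinfun.add_right blinfun.zero_right PP PA)
  ultimately show ?thesis by simp
qed

text \<open>A left inverse \<open>g\<close> is kept as a parameter so that an explicit formula can replace \<^const>\<open>inv_into\<close>.\<close>

lemma tangent_vectors_chart:
  fixes \<phi> g :: "'a::real_normed_vector \<Rightarrow> 'a"
  assumes \<phi>: "C1_diffeomorphism_on W \<phi>" and td: "top_direct_sum E0 E1"
    and op: "openin (top_of_set E0) (\<phi> ` (S \<inter> W))" and x: "x \<in> S" "x \<in> W"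
    and g: "\<And>w. w \<in> W \<Longrightarrow> g (\<phi> w) = w" "C1_on (\<phi> ` W) g" "(g has_derivative g') (at (\<phi> x))"
  shows "tangent_vectors S x = g' ` E0"
proof (intro equalityI subsetI)
  have W: "open W" "open (\<phi> ` W)" using \<phi> by (auto simp: C1_diffeomorphism_on_def)
  obtain Q :: "'a \<Rightarrow>\<^sub>L 'a" where Q: "\<And>x. x \<in> E0 \<longleftrightarrow> Q x = x"
    using top_direct_sum_projection[OF td] by metis
  fix v assume "v \<in> tangent_vectors S x"
  then obtain \<epsilon> c where c: "\<epsilon> > 0" "c ` {-\<epsilon><..<\<epsilon>} \<subseteq> S" "c 0 = x" "(c has_vector_derivative v) (at 0)"
    unfolding tangent_vectors_def by blast
  obtain \<phi>' where \<phi>': "(\<phi> has_derivative \<phi>') (at x)"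
    using \<phi> x unfolding C1_diffeomorphism_on_def C1_on_def by blast
  have "\<forall>\<^sub>F t in nhds 0. c t \<in> W"
    using has_vector_derivative_continuous[OF c(4)] W(1) x c(3)
    by (metis continuous_at eventually_nhds_x_imp_x tendsto_at_iff_tendsto_nhds topological_tendstoD)
  then obtain N where N: "open N" "0 \<in> N" "\<And>t. t \<in> N \<Longrightarrow> c t \<in> W"
    unfolding eventually_nhds by blast
  have d: "((\<lambda>t. \<phi> (c t)) has_vector_derivative \<phi>' v) (at 0)"
    using vector_derivative_diff_chain_within[OF c(4), of \<phi> \<phi>'] \<phi>' c(3)
    by (simp add: o_def has_derivative_at_withinI)
  \<comment> \<open>Near 0 the curve \<open>\<phi> \<circ> c\<close> lies in \<open>E0\<close>,
    where \<open>Q\<close> acts as the identity. Both curves have the same derivative, so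
    \<open>Q\<close> fixes \<open>\<phi>' v\<close>, which puts it in \<open>E0\<close>.\<close>
  have dQ: "((\<lambda>t. Q (\<phi> (c t))) has_vector_derivative Q (\<phi>' v)) (at 0)"
    by (rule bounded_linear.has_vector_derivative[OF blinfun.bounded_linear_right d])
  have QE: "Q (\<phi> (c t)) = \<phi> (c t)" if "t \<in> N \<inter> {-\<epsilon><..<\<epsilon>}" for t
  proof -
    have "c t \<in> S \<inter> W" using that N c(2) by auto
    then show ?thesis using openin_subset[OF op] Q by auto
  qed
  have "((\<lambda>t. \<phi> (c t)) has_vector_derivative Q (\<phi>' v)) (at 0)"
    by (rule has_vector_derivative_transform_within_open[where S = "N \<inter> {-\<epsilon><..<\<epsilon>}", OF dQ])
       (use N c(1) QE in \<open>auto intro: open_Int\<close>)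
  then have "Q (\<phi>' v) = \<phi>' v" using d by (metis vector_derivative_at)
  moreover have "g' (\<phi>' v) = v"
    by (rule has_derivative_left_inverse[OF W(1) x(2) g(1) \<phi>' g(3)])
  ultimately show "v \<in> g' ` E0" using Q by (metis imageI)
next
  fix v assume "v \<in> g' ` E0"
  then obtain e where e: "e \<in> E0" "v = g' e" by blast
  have s0: "subspace E0" using td by (simp add: top_direct_sum_def)
  obtain T where T: "open T" "\<phi> ` (S \<inter> W) = E0 \<inter> T" using op by (auto simp: openin_open)
  have xT: "\<phi> x \<in> E0 \<inter> T" using x T by blast
  \<comment> \<open>The required curve is the pullback under \<open>g\<close> of the straight line
    in \<open>E0\<close> through \<open>\<phi> x\<close> with direction \<open>e\<close>; relative
    openness keeps the line inside the image of \<open>S\<close> for small times.\<close>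
  define l where "l t = \<phi> x + t *\<^sub>R e" for t :: real
  have "l \<midarrow>0\<rightarrow> l 0" unfolding l_def by (intro tendsto_intros)
  then have "\<forall>\<^sub>F t in at 0. l t \<in> T"
    by (rule topological_tendstoD) (use T xT in \<open>auto simp: l_def\<close>)
  then obtain \<epsilon> where \<epsilon>: "\<epsilon> > 0" "\<And>t. t \<noteq> 0 \<Longrightarrow> \<bar>t\<bar> < \<epsilon> \<Longrightarrow> l t \<in> T"
    unfolding eventually_at by (auto simp: dist_norm)
  have l: "l t \<in> \<phi> ` (S \<inter> W)" if "t \<in> {-\<epsilon><..<\<epsilon>}" for t
  proof -
    have "l t \<in> E0" using xT e s0 by (simp add: l_def subspace_add subspace_scale)
    moreover have "l t \<in> T" using \<epsilon>(2)[of t] that xT by (cases "t = 0") (auto simp: l_def)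
    ultimately show ?thesis by (simp add: T)
  qed
  obtain D :: "'a \<Rightarrow> 'a \<Rightarrow>\<^sub>L 'a" where
    D: "\<And>y. y \<in> \<phi> ` W \<Longrightarrow> (g has_derivative D y) (at y)" "continuous_on (\<phi> ` W) D"
    using g(2) unfolding C1_on_def by blast
  have vd: "((\<lambda>t. g (l t)) has_vector_derivative D (l t) e) (at t)" if "t \<in> {-\<epsilon><..<\<epsilon>}" for t
  proof -
    have "(l has_vector_derivative e) (at t)"
      unfolding l_def by (auto intro!: derivative_eq_intros)
    then show ?thesis
      using vector_derivative_diff_chain_within[of l e t UNIV g "D (l t)"] D(1)[of "l t"] l[OF that]
      by (auto simp: o_def intro: has_derivative_at_withinI)
  qed
  have cl: "continuous_on {-\<epsilon><..<\<epsilon>} l" unfolding l_def by (intro continuous_intros)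
  have "l ` {-\<epsilon><..<\<epsilon>} \<subseteq> \<phi> ` W" using l by blast
  then have "continuous_on {-\<epsilon><..<\<epsilon>} (\<lambda>t. D (l t) e)"
    by (intro blinfun.continuous_on continuous_on_const continuous_on_compose2[OF D(2) cl])
  then have "(\<lambda>t. g (l t)) C1_differentiable_on {-\<epsilon><..<\<epsilon>}"
    unfolding C1_differentiable_on_def using vd by (intro exI[of _ "\<lambda>t. D (l t) e"] conjI ballI)
  moreover have "(\<lambda>t. g (l t)) ` {-\<epsilon><..<\<epsilon>} \<subseteq> S"
  proof (rule image_subsetI)
    fix t assume "t \<in> {-\<epsilon><..<\<epsilon>}"
    then obtain w where "w \<in> S" "w \<in> W" "l t = \<phi> w" using l by blast
    then show "g (l t) \<in> S" using g(1) by simp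
  qed
  moreover have "g (l 0) = x" by (simp add: l_def g(1) x)
  moreover have "blinfun_apply (D (l 0)) = g'" 
    using has_derivative_unique[OF D(1)[of "\<phi> x"] g(3)] x by (simp add: l_def)
  then have "((\<lambda>t. g (l t)) has_vector_derivative v) (at 0)" using vd[of 0] \<epsilon>(1) e by simp
  ultimately show "v \<in> tangent_vectors S x"
    unfolding tangent_vectors_def mem_Collect_eq using \<epsilon>(1)
    by (intro exI[of _ \<epsilon>] exI[of _ "\<lambda>t. g (l t)"] conjI)
qed

section \<open>Operators on subspaces\<close>

lemma operatorsD:
  assumes "T \<in> operators X Y"
  shows "u \<in> X \<Longrightarrow> T u \<in> Y" "u \<in> X \<Longrightarrow> v \<in> X \<Longrightarrow> T (u + v) = T u + T v"
    "u \<in> X \<Longrightarrow> T (r *\<^sub>R u) = r *\<^sub>R T u" "\<exists>K. \<forall>u\<in>X. norm (T u) \<le> K * norm u"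
  using assms unfolding operators_def by auto

lemma operators_zero: "T \<in> operators X Y \<Longrightarrow> subspace X \<Longrightarrow> T 0 = 0"
  using operatorsD(3)[of T X Y 0 0] by (simp add: subspace_0)

lemma restrict_blinfun_operators:
  fixes A :: "'a::real_normed_vector \<Rightarrow>\<^sub>L 'a"
  assumes "subspace X" "\<And>u. u \<in> X \<Longrightarrow> A u \<in> Y"
  shows "restrict A X \<in> operators X Y"
  using assms norm_blinfun[of A] unfolding operators_def
  by (auto simp: subspace_add subspace_scale blinfun.add_right blinfun.scaleR_right
      intro!: exI[of _ "norm A"])

text \<open>Members of \<open>operators X Y\<close> are \<open>undefined\<close> off
  \<open>X\<close>. Composing with a bounded map into \<open>X\<close> gives an honest bounded
  operator on the whole space.\<close>

lemma operators_blinfun_extension: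
  assumes T: "T \<in> operators X Y" and P: "bounded_linear P" "\<And>x. P x \<in> X"
  shows "bounded_linear (\<lambda>h. T (P h))"
proof -
  interpret P: bounded_linear P by (rule P)
  obtain K where K: "\<And>u. u \<in> X \<Longrightarrow> norm (T u) \<le> K * norm u" using operatorsD(4)[OF T] by blast
  obtain L where L: "\<And>x. norm (P x) \<le> norm x * L" using P.bounded by blast
  show ?thesis
  proof (rule bounded_linear_intro)
    fix x
    have "norm (T (P x)) \<le> K * norm (P x)" using K P(2) by blast
    also have "\<dots> \<le> \<bar>K\<bar> * norm (P x)" by (intro mult_right_mono) auto
    also have "\<dots> \<le> \<bar>K\<bar> * (norm x * L)" by (intro mult_left_mono L) auto
    finally show "norm (T (P x)) \<le> norm x * (\<bar>K\<bar> * L)" by (simp add: ac_simps)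
  qed (use operatorsD(2,3)[OF T] P(2) in \<open>auto simp: P.add P.scaleR\<close>)
qed

section \<open>The norm of an operator on a subspace\<close>

lemma operator_norm_on_bdd_above:
  assumes "\<exists>K. \<forall>u\<in>X. norm (T u) \<le> K * norm u"
  shows "bdd_above ((\<lambda>u. norm (T u) / norm u) ` X)"
proof -
  obtain K where K: "\<And>u. u \<in> X \<Longrightarrow> norm (T u) \<le> K * norm u" using assms by blast
  have "norm (T v) / norm v \<le> \<bar>K\<bar>" if "v \<in> X" for v
    using K[OF that] by (cases "v = 0") (auto simp: divide_le_eq intro: order_trans mult_right_mono)
  then show ?thesis by (auto simp: bdd_above_def)
qed

lemma operator_norm_on_bound:
  assumes "\<exists>K. \<forall>u\<in>X. norm (T u) \<le> K * norm u" "u \<in> X"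
  shows "norm (T u) \<le> operator_norm_on X T * norm u"
proof (cases "u = 0")
  case False
  have "norm (T u) / norm u \<le> operator_norm_on X T"
    unfolding operator_norm_on_def
    by (rule cSUP_upper[OF assms(2) operator_norm_on_bdd_above[OF assms(1)]])
  then show ?thesis using False by (simp add: divide_le_eq)
qed (use assms in auto)

text \<open>At \<open>u = 0\<close> the quotient is a division by zero with value 0, and the
  supremum dominates it.\<close>

lemma operator_norm_on_nonneg:
  assumes "\<exists>K. \<forall>u\<in>X. norm (T u) \<le> K * norm u" "0 \<in> X"
  shows "0 \<le> operator_norm_on X T"
  using cSUP_upper[OF assms(2) operator_norm_on_bdd_above[OF assms(1)]]
  by (simp add: operator_norm_on_def)

lemma operator_norm_on_le:
  assumes "0 \<le> K" "0 \<in> X" "\<And>u. u \<in> X \<Longrightarrow> norm (T u) \<le> K * norm u"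
  shows "operator_norm_on X T \<le> K"
  unfolding operator_norm_on_def
proof (rule cSUP_least)
  show "norm (T u) / norm u \<le> K" if "u \<in> X" for u
    using assms(1) assms(3)[OF that] by (cases "u = 0") (auto simp: divide_le_eq)
qed (use assms in auto)

section \<open>Transfer of derivatives between the subspace and the whole space\<close>

lemma has_derivative_between_epsilon:
  assumes "has_derivative_between X Y V f T x" "subspace X" "e > 0"
  obtains d where "d > 0"
    "\<And>y. y \<in> V \<Longrightarrow> norm (y - x) < d \<Longrightarrow> norm (f y - f x - T (y - x)) \<le> e * norm (y - x)"
proof -
  have T: "T \<in> operators X Y" and
    lim: "((\<lambda>y. norm (f y - f x - T (y - x)) / norm (y - x)) \<longlongrightarrow> 0) (at x within V)"
    using assms(1) by (auto simp: has_derivative_between_def)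
  obtain d where d: "d > 0" "\<And>y. y \<in> V \<Longrightarrow> y \<noteq> x \<Longrightarrow> dist y x < d \<Longrightarrow>
      norm (f y - f x - T (y - x)) / norm (y - x) < e"
    using tendstoD[OF lim assms(3)] by (auto simp: eventually_at)
  \<comment> \<open>The limit says nothing at \<open>y = x\<close>; there both sides vanish because
    \<open>T 0 = 0\<close>.\<close>
  have "norm (f y - f x - T (y - x)) \<le> e * norm (y - x)" if "y \<in> V" "norm (y - x) < d" for y
  proof (cases "y = x")
    case False
    then show ?thesis using d(2)[of y] that by (simp add: dist_norm pos_divide_less_eq)
  qed (use operators_zero[OF T assms(2)] in simp)
  then show thesis using that d(1) by blast
qed

text \<open>An increment of \<open>w\<close> reaches \<open>f\<close> only through \<open>P\<close>,
  hence as an increment in \<open>X\<close> that is longer by a factor of at most \<open>L\<close>.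
  This is why the tolerance is \<open>e / L\<close>.\<close>

lemma has_derivative_between_extend:
  assumes D: "has_derivative_between X Y V f T (P z)" and X: "subspace X"
    and V: "openin (top_of_set X) V" "P z \<in> V" and P: "bounded_linear P" "\<And>x. P x \<in> X"
  shows "((\<lambda>w. f (P w)) has_derivative (\<lambda>h. T (P h))) (at z)"
  unfolding has_derivative_at_alt
proof (intro conjI allI impI)
  have T: "T \<in> operators X Y" using D by (simp add: has_derivative_between_def)
  show "bounded_linear (\<lambda>h. T (P h))" by (rule operators_blinfun_extension[OF T P])
  fix e :: real assume "e > 0"
  obtain L where L: "L > 0" "\<And>x. norm (P x) \<le> norm x * L"
    using bounded_linear.pos_bounded[OF P(1)] by blast
  have Pd: "P x - P y = P (x - y)" for x y
    using P(1) by (simp add: bounded_linear.linear linear_diff)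
  obtain d where d: "d > 0" "\<And>y. y \<in> V \<Longrightarrow> norm (y - P z) < d \<Longrightarrow>
      norm (f y - f (P z) - T (y - P z)) \<le> (e / L) * norm (y - P z)"
    using has_derivative_between_epsilon[OF D X, of "e / L"] \<open>e > 0\<close> L(1) by auto
  obtain r where r: "r > 0" "\<And>y. y \<in> X \<Longrightarrow> dist y (P z) < r \<Longrightarrow> y \<in> V"
    using V unfolding openin_euclidean_subtopology_iff by blast
  show "\<exists>\<delta>>0. \<forall>w. norm (w - z) < \<delta> \<longrightarrow> norm (f (P w) - f (P z) - T (P (w - z))) \<le> e * norm (w - z)"
  \<comment> \<open>Here \<open>d\<close> secures the derivative estimate and \<open>r\<close> keeps
    \<open>P w\<close> inside the relatively open \<open>V\<close>.\<close>
  proof (intro exI[of _ "min d r / L"] conjI allI impI)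
    show "min d r / L > 0" using d r L by simp
    fix w assume "norm (w - z) < min d r / L"
    then have "norm (w - z) * L < min d r" using L(1) by (simp add: pos_less_divide_eq)
    then have lt: "norm (P w - P z) < min d r" using L(2)[of "w - z"] Pd by simp
    then have "P w \<in> V" using r(2)[OF P(2)[of w]] by (simp add: dist_norm)
    then have "norm (f (P w) - f (P z) - T (P w - P z)) \<le> (e / L) * norm (P w - P z)"
      using d(2) lt by simp
    also have "\<dots> \<le> (e / L) * (norm (w - z) * L)"
      using L \<open>e > 0\<close> Pd by (intro mult_left_mono) auto
    finally show "norm (f (P w) - f (P z) - T (P (w - z))) \<le> e * norm (w - z)"
      using L(1) Pd by simp
  qed
qed

text \<open>Composition with \<open>P\<close> is Lipschitz for the operator norms with constant
  \<open>L\<close>, so continuity in the norm on \<open>X\<close> passes to continuity in the space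
  of bounded operators.\<close>

lemma operator_continuous_on_extend:
  fixes P :: "'a::real_normed_vector \<Rightarrow> 'a"
  assumes D: "operator_continuous_on X V D" "\<And>x. x \<in> V \<Longrightarrow> D x \<in> operators X Y"
    and X: "subspace X" and P: "bounded_linear P" "\<And>x. P x \<in> X"
  shows "continuous_on V (\<lambda>x. Blinfun (\<lambda>h. D x (P h)))"
  unfolding continuous_on_def
proof
  fix x assume x: "x \<in> V"
  define A where "A y = Blinfun (\<lambda>h. D y (P h))" for y
  have A: "A y h = D y (P h)" if "y \<in> V" for y h
    unfolding A_def
    using bounded_linear_Blinfun_apply[OF operators_blinfun_extension[OF D(2)[OF that] P]] by simp
  obtain L where L: "L > 0" "\<And>x. norm (P x) \<le> norm x * L"
    using bounded_linear.pos_bounded[OF P(1)] by blast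
  let ?N = "\<lambda>y. operator_norm_on X (\<lambda>h. D y h - D x h)"
  have le: "norm (A y - A x) \<le> ?N y * L" if y: "y \<in> V" for y
  proof (rule norm_blinfun_bound)
    obtain K K' where K: "\<forall>u\<in>X. norm (D y u) \<le> K * norm u" "\<forall>u\<in>X. norm (D x u) \<le> K' * norm u"
      using operatorsD(4)[OF D(2)] x y by metis
    \<comment> \<open>The real supremum \<open>?N y\<close> is an upper bound only for a set that is
      bounded above, so a bound for the difference comes first.\<close>
    have "norm (D y u - D x u) \<le> (K + K') * norm u" if "u \<in> X" for u
      using norm_triangle_ineq4[of "D y u" "D x u"] K that by (fastforce simp: algebra_simps)
    then have b: "\<exists>K. \<forall>u\<in>X. norm (D y u - D x u) \<le> K * norm u" by blast
    have N0: "0 \<le> ?N y" using operator_norm_on_nonneg[OF b] X by (simp add: subspace_0)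
    then show "0 \<le> ?N y * L" using L by simp
    fix h
    have "norm ((A y - A x) h) = norm (D y (P h) - D x (P h))"
      using x y by (simp add: blinfun.diff_left A)
    also have "\<dots> \<le> ?N y * norm (P h)" by (rule operator_norm_on_bound[OF b P(2)])
    also have "\<dots> \<le> ?N y * (norm h * L)" by (intro mult_left_mono L N0)
    finally show "norm ((A y - A x) h) \<le> ?N y * L * norm h" by (simp add: ac_simps)
  qed
  have "(?N \<longlongrightarrow> 0) (at x within V)" using D(1) x by (simp add: operator_continuous_on_def)
  then have "((\<lambda>y. ?N y * L) \<longlongrightarrow> 0) (at x within V)" by (rule tendsto_mult_left_zero)
  moreover have "\<forall>\<^sub>F y in at x within V. norm (A y - A x) \<le> ?N y * L"
    using le by (simp add: eventually_at_filter)
  ultimately have "((\<lambda>y. A y - A x) \<longlongrightarrow> 0) (at x within V)"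
    using Lim_null_comparison[of "\<lambda>y. A y - A x" "\<lambda>y. ?N y * L"] by simp
  then have "(A \<longlongrightarrow> A x) (at x within V)" by (simp add: LIM_zero_iff)
  then show "((\<lambda>y. Blinfun (\<lambda>h. D y (P h))) \<longlongrightarrow> Blinfun (\<lambda>h. D x (P h))) (at x within V)"
    by (simp add: A_def[abs_def])
qed

lemma C1_on_extend:
  fixes P :: "'a::real_normed_vector \<Rightarrow> 'a"
  assumes D: "\<And>x. x \<in> V \<Longrightarrow> has_derivative_between X Y V f (D x) x" "operator_continuous_on X V D"
    and X: "subspace X" and V: "openin (top_of_set X) V" and P: "bounded_linear P" "\<And>x. P x \<in> X"
  shows "C1_on {w. P w \<in> V} (\<lambda>w. f (P w))"
proof (rule C1_onI)
  have op: "D x \<in> operators X Y" if "x \<in> V" for x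
    using D(1)[OF that] by (simp add: has_derivative_between_def)
  show "continuous_on {w. P w \<in> V} (\<lambda>w. Blinfun (\<lambda>h. D (P w) (P h)))"
    by (rule continuous_on_compose2[OF operator_continuous_on_extend[OF D(2) op X P]])
       (auto intro: bounded_linear.continuous_on[OF P(1)] continuous_on_id)
  fix w assume "w \<in> {w. P w \<in> V}"
  then show "((\<lambda>w. f (P w)) has_derivative blinfun_apply (Blinfun (\<lambda>h. D (P w) (P h)))) (at w)"
    using has_derivative_between_extend[OF D(1) X V _ P, of w]
      operators_blinfun_extension[OF op P, of "P w"] by (simp add: bounded_linear_Blinfun_apply)
qed

text \<open>Increments between points of \<open>V\<close> stay in \<open>X\<close>, where
  \<open>A\<close> and its restriction agree; the limit along \<open>V\<close> is inherited from the
  full limit.\<close>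

lemma has_derivative_between_restrict:
  fixes A :: "'a::real_normed_vector \<Rightarrow>\<^sub>L 'a"
  assumes f: "(f has_derivative blinfun_apply A) (at x)" and A: "\<And>u. u \<in> X \<Longrightarrow> A u \<in> Y"
    and X: "subspace X" and V: "V \<subseteq> X" "x \<in> V"
  shows "has_derivative_between X Y V f (restrict A X) x"
  unfolding has_derivative_between_def
proof
  show "restrict A X \<in> operators X Y" by (rule restrict_blinfun_operators[OF X A])
  have "((\<lambda>y. norm (f y - f x - A (y - x)) / norm (y - x)) \<longlongrightarrow> 0) (at x within V)"
    using has_derivative_at_withinI[OF f] unfolding has_derivative_iff_norm by simp
  then show "((\<lambda>y. norm (f y - f x - restrict A X (y - x)) / norm (y - x)) \<longlongrightarrow> 0) (at x within V)"
    by (rule Lim_transform_eventually)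
       (use V X in \<open>auto simp: eventually_at_filter subspace_diff subset_iff\<close>)
qed

lemma operator_continuous_on_restrict:
  fixes A :: "'a::real_normed_vector \<Rightarrow> 'a \<Rightarrow>\<^sub>L 'a"
  assumes "continuous_on V A" "subspace X"
    and D: "\<And>x. x \<in> V \<Longrightarrow> D x = restrict (blinfun_apply (A x)) X"
  shows "operator_continuous_on X V D"
  unfolding operator_continuous_on_def
proof
  fix x assume x: "x \<in> V"
  let ?N = "\<lambda>y. operator_norm_on X (\<lambda>h. D y h - D x h)"
  have "(A \<longlongrightarrow> A x) (at x within V)" using assms(1) x by (simp add: continuous_on_def)
  then have "((\<lambda>y. norm (A y - A x)) \<longlongrightarrow> 0) (at x within V)"
    by (simp add: LIM_zero_iff tendsto_norm_zero_iff)
  moreover have "norm (?N y) \<le> norm (A y - A x)" if y: "y \<in> V" for y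
  proof -
    have b: "norm (D y u - D x u) \<le> norm (A y - A x) * norm u" if "u \<in> X" for u
      using norm_blinfun[of "A y - A x" u] that x y by (simp add: D blinfun.diff_left)
    have "0 \<le> ?N y" using b assms(2) by (intro operator_norm_on_nonneg) (auto simp: subspace_0)
    moreover have "?N y \<le> norm (A y - A x)"
      using b assms(2) by (intro operator_norm_on_le) (auto simp: subspace_0)
    ultimately show ?thesis by simp
  qed
  then have "\<forall>\<^sub>F y in at x within V. norm (?N y) \<le> norm (A y - A x)"
    by (simp add: eventually_at_filter)
  ultimately show "(?N \<longlongrightarrow> 0) (at x within V)"
    using Lim_null_comparison[of ?N "\<lambda>y. norm (A y - A x)"] by simp
qed

lemma graph_operator_eqI:
  assumes "top_direct_sum M0 Es" "top_direct_sum (M x) Es"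
    and "T \<in> operators M0 Es" "M x = {e + T e | e. e \<in> M0}"
  shows "graph_operator M M0 Es x = T"
  unfolding graph_operator_def
  by (rule the1_equality[OF graph_operator_ex1[of M0 Es M x, OF assms(1,2)]]) (use assms in blast)

lemma graph_operator_graph:
  assumes "top_direct_sum M0 Es" "top_direct_sum (M x) Es"
  shows "M x = {e + graph_operator M M0 Es x e | e. e \<in> M0}"
  using theI'[OF graph_operator_ex1[of M0 Es M x, OF assms]] unfolding graph_operator_def by blast

section \<open>Integral manifolds as graphs\<close>

lemma C1_integrable_atI:
  fixes M :: "'a::real_normed_vector \<Rightarrow> 'a set"
  assumes td: "top_direct_sum (M x0) Es" and V: "openin (top_of_set (M x0)) V" "proj_along (M x0) Es x0 \<in> V"
    and \<psi>: "C1_between (M x0) Es V \<psi>" "\<And>x. x \<in> V \<Longrightarrow> x + \<psi> x \<in> cofinal_set \<Lambda> M Es"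
    and cont: "operator_continuous_on (M x0) V (\<lambda>x. graph_operator M (M x0) Es (x + \<psi> x))"
    and der: "\<And>x. x \<in> V \<Longrightarrow> has_derivative_between (M x0) Es V \<psi> (graph_operator M (M x0) Es (x + \<psi> x)) x"
    and x0: "\<psi> (proj_along (M x0) Es x0) = proj_along Es (M x0) x0"
  shows "C1_integrable_at \<Lambda> M x0"
proof -
  define \<alpha> where "\<alpha> x = graph_operator M (M x0) Es (x + \<psi> x)" for x
  obtain P :: "'a \<Rightarrow>\<^sub>L 'a" where P: "proj_along (M x0) Es = blinfun_apply P" "\<And>x. P x \<in> M x0"
    "\<And>x. x \<in> M x0 \<longleftrightarrow> P x = x" "\<And>x. x \<in> Es \<longleftrightarrow> P x = 0" "\<And>x. proj_along Es (M x0) x = x - P x"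
    using top_direct_sum_projection[OF td] by metis
  have X: "subspace (M x0)" using td by (simp add: top_direct_sum_def)
  have VX: "V \<subseteq> M x0" using openin_subset[OF V(1)] by simp
  have blP: "bounded_linear (blinfun_apply P)" by (rule blinfun.bounded_linear_right)
  \<comment> \<open>The chart lives on the whole cylinder over \<open>V\<close> in the direction of
    \<open>Es\<close>.\<close>
  define W where "W = {w. P w \<in> V}"
  have oW: "open W"
  proof -
    obtain T where T: "open T" "V = M x0 \<inter> T" using V(1) by (auto simp: openin_open)
    then have "W = blinfun_apply P -` T" using P(2) by (auto simp: W_def)
    then show ?thesis using T(1) by (auto intro!: open_vimage continuous_intros)
  qed
  define \<Psi> where "\<Psi> w = \<psi> (P w)" for w
  have C1\<Psi>: "C1_on W \<Psi>"
    unfolding W_def \<Psi>_def using C1_on_extend[OF der cont X V(1) blP P(2)] by simp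
  have P\<Psi>: "P (\<Psi> w) = 0" if "w \<in> W" for w
    using that \<psi>(1) P(4) by (auto simp: C1_between_def W_def \<Psi>_def)
  define \<phi> where "\<phi> w = w - \<Psi> w" for w
  define g where "g w = w + \<Psi> w" for w
  \<comment> \<open>The values of \<open>\<psi>\<close> lie in the kernel of \<open>P\<close>, so
    adding or subtracting \<open>\<Psi> w\<close> leaves the \<open>P\<close> component alone. Hence
    the two shears preserve \<open>W\<close> and undo each other.\<close>
  have P\<phi>: "P (\<phi> w) = P w" and Pg: "P (g w) = P w" if "w \<in> W" for w
    using P\<Psi>[OF that] by (auto simp: \<phi>_def g_def blinfun.diff_right blinfun.add_right)
  have in_W: "\<phi> w \<in> W" "g w \<in> W" if "w \<in> W" for w
    using that P\<phi> Pg by (simp_all add: W_def)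
  have g\<phi>: "g (\<phi> w) = w" and \<phi>g: "\<phi> (g w) = w" if "w \<in> W" for w
    using P\<phi>[OF that] Pg[OF that] by (simp_all add: g_def[of "\<phi> w"] \<phi>_def[of "g w"] \<Psi>_def)
      (simp_all add: \<phi>_def g_def \<Psi>_def)
  have \<phi>W: "\<phi> ` W = W" using in_W \<phi>g by force
  have idC1: "C1_on W (\<lambda>w. w)" using C1_on_blinfun[of W id_blinfun] by simp
  have C1\<phi>: "C1_on W \<phi>" and C1g: "C1_on W g"
    unfolding \<phi>_def g_def by (intro C1_on_diff C1_on_add idC1 C1\<Psi>)+
  have diffeo: "C1_diffeomorphism_on W \<phi>"
    by (rule C1_diffeomorphism_onI[of _ _ g]) (use oW \<phi>W C1\<phi> C1g g\<phi> in auto)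
  define S where "S = (\<lambda>x. x + \<psi> x) ` V"
  have S_eq: "x + \<psi> x = g x" and VW: "x \<in> W" if "x \<in> V" for x
    using that VX P(3) by (auto simp: g_def \<Psi>_def W_def)
  have SW: "S \<subseteq> W" using S_eq VW in_W by (auto simp: S_def)
  have "\<phi> ` (S \<inter> W) = V"
  proof -
    have "\<phi> (x + \<psi> x) = x" if "x \<in> V" for x using S_eq VW \<phi>g that by simp
    then show ?thesis using SW by (force simp: S_def)
  qed
  then have op: "openin (top_of_set (M x0)) (\<phi> ` (S \<inter> W))" using V(1) by simp
  have "C1_submanifold S"
    unfolding C1_submanifold_def using SW td diffeo op by blast
  moreover have "x0 \<in> S"
    using x0 V(2) by (auto simp: P S_def intro!: image_eqI[of _ _ "P x0"])
  moreover have "S \<subseteq> \<Lambda>" using \<psi>(2) by (auto simp: S_def cofinal_set_def)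
  moreover have "M y = tangent_vectors S y" if yS: "y \<in> S" for y
  proof -
    obtain x where x: "x \<in> V" "y = x + \<psi> x" using yS by (auto simp: S_def)
    have y: "y \<in> W" "\<phi> y = x" using x S_eq VW \<phi>g in_W by auto
    have "P x = x" using x VX P(3) by blast
    then have "(\<Psi> has_derivative (\<lambda>h. \<alpha> x (P h))) (at x)"
      using has_derivative_between_extend[OF _ X V(1) _ blP P(2), of Es \<psi> "\<alpha> x" x] der[OF x(1)] x(1)
      by (simp add: \<alpha>_def \<Psi>_def[abs_def])
    \<comment> \<open>The derivative of the inverse shear sends \<open>e\<close> in
      \<open>M x0\<close> to \<open>e + \<alpha> x e\<close>, so the tangent space is the graph of
      \<open>\<alpha> x\<close>.\<close>
    then have "(g has_derivative (\<lambda>h. h + \<alpha> x (P h))) (at (\<phi> y))"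
      unfolding g_def y(2) by (rule has_derivative_add[OF has_derivative_ident])
    then have "tangent_vectors S y = (\<lambda>h. h + \<alpha> x (P h)) ` M x0"
      using C1g g\<phi> y yS \<phi>W by (intro tangent_vectors_chart[OF diffeo td op]) auto
    also have "\<dots> = {e + \<alpha> x e | e. e \<in> M x0}" using P(3) by force
    also have "\<dots> = M y"
      using graph_operator_graph[OF td, of M y] \<psi>(2)[OF x(1)] by (simp add: \<alpha>_def x(2) cofinal_set_def)
    finally show ?thesis by simp
  qed
  ultimately show ?thesis unfolding C1_integrable_at_def 
    \<comment> \<open>The graph is already a submanifold of the whole space, which serves as the
      neighborhood.\<close>
    by - (rule exI[of _ UNIV], rule exI[of _ S], simp)
qed

text \<open>This concerns \<open>S\<close> alone, without the family \<open>M\<close>. The condition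
  \<open>P (G y) = P y\<close> makes \<open>G y - y\<close> take values in \<open>Es\<close>, and
  the last clause reads off tangent spaces from the derivative of \<open>G\<close>.\<close>

lemma C1_submanifold_graph:
  fixes S :: "'a::banach set"
  assumes S: "C1_submanifold S" "x0 \<in> S"
  defines "M0 \<equiv> tangent_vectors S x0"
  obtains Es N and P :: "'a \<Rightarrow>\<^sub>L 'a" and G :: "'a \<Rightarrow> 'a" and G' :: "'a \<Rightarrow> 'a \<Rightarrow>\<^sub>L 'a"
  where "top_direct_sum M0 Es" "proj_along M0 Es = blinfun_apply P"
    "open N" "P x0 \<in> N" "G (P x0) = x0"
    "\<And>y. y \<in> N \<Longrightarrow> P (G y) = P y"
    "\<And>y. y \<in> N \<Longrightarrow> (G has_derivative blinfun_apply (G' y)) (at y)" "continuous_on N G'"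
    "\<And>y. y \<in> N \<inter> M0 \<Longrightarrow> G y \<in> S \<and> tangent_vectors S (G y) = blinfun_apply (G' y) ` M0"
proof -
  obtain W E0 E1 and \<phi> :: "'a \<Rightarrow> 'a" where W: "x0 \<in> W" and td: "top_direct_sum E0 E1"
    and diffeo: "C1_diffeomorphism_on W \<phi>" and op: "openin (top_of_set E0) (\<phi> ` (S \<inter> W))"
    using S unfolding C1_submanifold_def by blast
  have oW: "open W" "open (\<phi> ` W)" "inj_on \<phi> W" and C1\<phi>: "C1_on W \<phi>" "C1_on (\<phi> ` W) (inv_into W \<phi>)"
    using diffeo by (auto simp: C1_diffeomorphism_on_def)
  define g where "g = inv_into W \<phi>"
  have g\<phi>: "g (\<phi> w) = w" if "w \<in> W" for w using that oW(3) by (simp add: g_def)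
  obtain Q :: "'a \<Rightarrow>\<^sub>L 'a" where Q: "\<And>x. Q x \<in> E0" "\<And>x. x \<in> E0 \<longleftrightarrow> Q x = x"
    using top_direct_sum_projection[OF td] by metis
  have QQ: "Q (Q x) = Q x" for x using Q by blast
  obtain K :: "'a \<Rightarrow>\<^sub>L 'a" where K: "(\<phi> has_derivative blinfun_apply K) (at x0)"
    using C1\<phi>(1) W unfolding C1_on_def by blast
  obtain L :: "'a \<Rightarrow>\<^sub>L 'a" where L: "(g has_derivative blinfun_apply L) (at (\<phi> x0))"
    using C1\<phi>(2) W unfolding C1_on_def g_def by blast
  have LK: "L (K h) = h" for h
    by (rule has_derivative_left_inverse[OF oW(1) W g\<phi> K L])
  have KL: "K (L h) = h" for h
    by (rule has_derivative_left_inverse[OF oW(2) _ _ L, of \<phi>])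
       (use W K g\<phi> in auto)
  have M0: "M0 = blinfun_apply L ` E0"
    unfolding M0_def
    by (rule tangent_vectors_chart[OF diffeo td op S(2) W g\<phi> _ L]) (use C1\<phi> in \<open>auto simp: g_def\<close>)
  \<comment> \<open>\<open>P\<close> is \<open>Q\<close> conjugated by the isomorphism
    \<open>K\<close> with inverse \<open>L\<close>; it inherits idempotence, and its fixed space is
    the image of \<open>E0\<close> under \<open>L\<close>, which is \<open>M0\<close>.\<close>
  define P where "P = L o\<^sub>L Q o\<^sub>L K"
  have P: "P h = L (Q (K h))" for h by (simp add: P_def)
  define Es where "Es = {h. P h = 0}"
  have M0P: "M0 = {h. P h = h}"
  proof (intro equalityI subsetI)
    fix h assume "h \<in> M0"
    then show "h \<in> {h. P h = h}" using Q(2) by (auto simp: M0 P KL)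
  next
    fix h assume "h \<in> {h. P h = h}"
    then have "h = L (Q (K h))" by (simp add: P)
    then show "h \<in> M0" using Q(1) M0 by blast
  qed
  have PP: "P (P h) = P h" for h by (simp add: P KL QQ)
  have tdM: "top_direct_sum M0 Es"
    unfolding M0P Es_def by (rule top_direct_sum_idempotent[OF PP])
  have projP: "proj_along M0 Es = blinfun_apply P"
  proof
    fix x show "proj_along M0 Es x = P x"
      using tdM by (intro proj_along_eqI)
        (auto simp: top_direct_sum_def M0P Es_def PP blinfun.diff_right)
  qed
  txt \<open>
    \<open>H\<close> straightens \<open>S\<close> like \<open>\<phi>\<close> does, but in addition \<open>P \<circ> H = P\<close>, and its derivative at \<open>x0\<close> is the
    identity.
  \<close>
  define H where "H w = P w + L (\<phi> w - Q (\<phi> w))" for w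
  have PH: "P (H w) = P w" for w
    \<comment> \<open>The second summand of \<open>H\<close> is killed:
      \<open>P L (1 - Q) = L Q (1 - Q) = 0\<close>.\<close>
    by (simp add: H_def blinfun.add_right PP) (simp add: P KL blinfun.diff_right QQ blinfun.zero_right)
  have C1H: "C1_on W H"
    unfolding H_def
    by (intro C1_on_add C1_on_blinfun C1_on_blinfun_comp[OF C1_on_diff] C1_on_blinfun_comp C1\<phi>)
  have "(H has_derivative (\<lambda>h. P h + L (K h - Q (K h)))) (at x0)"
    unfolding H_def
    by (intro has_derivative_add has_derivative_diff K
        bounded_linear.has_derivative[OF blinfun.bounded_linear_right]
        bounded_linear_imp_has_derivative blinfun.bounded_linear_right)
  \<comment> \<open>The terms with \<open>Q\<close> cancel and leave \<open>L K\<close>, the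
    identity.\<close>
  then have H'x0: "(H has_derivative (\<lambda>h. h)) (at x0)"
    by (simp add: P blinfun.diff_right LK)
  obtain T where T: "open T" "\<phi> ` (S \<inter> W) = E0 \<inter> T" using op by (auto simp: openin_open)
  \<comment> \<open>On \<open>W1\<close> the point \<open>\<phi> w\<close> lies in \<open>T\<close>,
    so that \<open>w \<in> S\<close> amounts to \<open>\<phi> w \<in> E0\<close>.\<close>
  define W1 where "W1 = W \<inter> \<phi> -` T"
  have W1: "open W1" "x0 \<in> W1" "W1 \<subseteq> W"
    using continuous_open_preimage[OF C1_on_continuous_on[OF C1\<phi>(1)] oW(1) T(1)] T(2) S(2) W
    by (auto simp: W1_def)
  obtain U where U: "open U" "x0 \<in> U" "U \<subseteq> W1" and dH: "C1_diffeomorphism_on U H"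
    using C1_local_inverse_at_id[OF W1(1,2) C1_on_subset[OF C1H W1(3)] H'x0] .
  \<comment> \<open>Since \<open>P (H w) = P w\<close>, membership of \<open>H w\<close> in
    \<open>M0\<close> says that the second summand of \<open>H w\<close> vanishes. As
    \<open>L\<close> is injective, this means \<open>\<phi> w = Q (\<phi> w)\<close>.\<close>
  have SH: "w \<in> S \<longleftrightarrow> H w \<in> M0" if w: "w \<in> U" for w
  proof
    have wW: "w \<in> W" "\<phi> w \<in> T" using w U W1_def by auto
    show "H w \<in> M0" if "w \<in> S"
    proof -
      have "\<phi> w \<in> E0" using that wW T(2) by blast
      then show ?thesis using Q(2) by (simp add: H_def M0P PP blinfun.zero_right)
    qed
    show "w \<in> S" if "H w \<in> M0"
    proof -
      have "L (\<phi> w - Q (\<phi> w)) = 0" using that PH[of w] by (simp add: M0P H_def)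
      then have "\<phi> w - Q (\<phi> w) = 0" by (metis KL blinfun.zero_right)
      then have "\<phi> w \<in> E0 \<inter> T" using Q(2) wW by simp
      then obtain v where "v \<in> S" "v \<in> W" "\<phi> w = \<phi> v" using T(2) by blast
      then show ?thesis using oW(3) wW by (metis inj_onD)
    qed
  qed
  define N where "N = H ` U"
  define G where "G = inv_into U H"
  have N: "open N" "C1_on N G" and injH: "inj_on H U"
    using dH by (auto simp: C1_diffeomorphism_on_def N_def G_def)
  have GH: "G (H w) = w" if "w \<in> U" for w using that injH by (simp add: G_def)
  have GU: "G y \<in> U" "H (G y) = y" if "y \<in> N" for y using that GH by (auto simp: N_def)
  obtain G' :: "'a \<Rightarrow> 'a \<Rightarrow>\<^sub>L 'a" where
    G': "\<And>y. y \<in> N \<Longrightarrow> (G has_derivative blinfun_apply (G' y)) (at y)" "continuous_on N G'"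
    using N(2) unfolding C1_on_def by blast
  \<comment> \<open>Thus \<open>H\<close> on \<open>U\<close> is itself a chart of \<open>S\<close>,
    with model splitting \<open>M0\<close>, \<open>Es\<close>.\<close>
  have HSU: "H ` (S \<inter> U) = M0 \<inter> N" using SH by (auto simp: N_def)
  then have opH: "openin (top_of_set M0) (H ` (S \<inter> U))" using N(1) by (simp add: openin_open_Int)
  \<comment> \<open>\<open>H x0\<close> lies in \<open>M0\<close>, hence equals its own projection,
    which is \<open>P x0\<close>.\<close>
  have Hx0: "H x0 = P x0" using SH[OF U(2)] S(2) PH[of x0] by (simp add: M0P)
  show thesis
  proof
    show "P x0 \<in> N" "G (P x0) = x0" using Hx0 U(2) GH by (auto simp: N_def simp flip: Hx0)
    show "P (G y) = P y" if "y \<in> N" for y using PH[of "G y"] GU[OF that] by simp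
    show "G y \<in> S \<and> tangent_vectors S (G y) = blinfun_apply (G' y) ` M0" if y: "y \<in> N \<inter> M0" for y
    proof
      show GS: "G y \<in> S" using SH[of "G y"] GU[of y] y by simp
      show "tangent_vectors S (G y) = blinfun_apply (G' y) ` M0"
        by (rule tangent_vectors_chart[OF dH tdM opH GS _ GH])
           (use GU[of y] y N G' in \<open>auto simp: N_def[symmetric]\<close>)
    qed
  qed (fact tdM projP N G')+
qed

theorem theorem2p2:
  fixes \<Lambda> :: "'a::banach set" and M :: "'a \<Rightarrow> 'a set" and x0 :: 'a
  assumes "open \<Lambda>" and "x0 \<in> \<Lambda>" and "\<forall>x\<in>\<Lambda>. subspace (M x)"
  shows "C1_integrable_at \<Lambda> M x0 \<longleftrightarrow>
    (\<exists>Es V \<psi>.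
       top_direct_sum (M x0) Es \<and>
       openin (top_of_set (M x0)) V \<and> proj_along (M x0) Es x0 \<in> V \<and>
       C1_between (M x0) Es V \<psi> \<and>
       (\<forall>x\<in>V. x + \<psi> x \<in> cofinal_set \<Lambda> M Es) \<and>
       operator_continuous_on (M x0) V (\<lambda>x. graph_operator M (M x0) Es (x + \<psi> x)) \<and>
       (\<forall>x\<in>V. has_derivative_between (M x0) Es V \<psi>
                 (graph_operator M (M x0) Es (x + \<psi> x)) x) \<and>
       \<psi> (proj_along (M x0) Es x0) = proj_along Es (M x0) x0)"
proof
  assume "C1_integrable_at \<Lambda> M x0"
  then obtain S where S: "C1_submanifold S" "x0 \<in> S" "S \<subseteq> \<Lambda>" "\<And>x. x \<in> S \<Longrightarrow> M x = tangent_vectors S x"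
    unfolding C1_integrable_at_def by blast
  obtain Es N and P :: "'a \<Rightarrow>\<^sub>L 'a" and G and G' :: "'a \<Rightarrow> 'a \<Rightarrow>\<^sub>L 'a" where
    td: "top_direct_sum (M x0) Es" and P: "proj_along (M x0) Es = blinfun_apply P"
    and N: "open N" "P x0 \<in> N" and Gx0: "G (P x0) = x0" and PG: "\<And>y. y \<in> N \<Longrightarrow> P (G y) = P y"
    and G': "\<And>y. y \<in> N \<Longrightarrow> (G has_derivative blinfun_apply (G' y)) (at y)" "continuous_on N G'"
    and GS: "\<And>y. y \<in> N \<inter> M x0 \<Longrightarrow> G y \<in> S \<and> tangent_vectors S (G y) = blinfun_apply (G' y) ` M x0"
    using C1_submanifold_graph[OF S(1,2)] S(4)[OF S(2)] by metis
  have P': "\<And>x. P x \<in> M x0" "\<And>x. x \<in> M x0 \<longleftrightarrow> P x = x" "\<And>x. x \<in> Es \<longleftrightarrow> P x = 0"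
    "\<And>x. proj_along Es (M x0) x = x - P x"
    using top_direct_sum_projection[OF td] P by metis+
  have X: "subspace (M x0)" using td by (simp add: top_direct_sum_def)
  define V where "V = M x0 \<inter> N"
  define \<psi> where "\<psi> y = G y - y" for y
  define A where "A y = G' y - id_blinfun" for y
  have A: "(\<psi> has_derivative blinfun_apply (A y)) (at y)" if "y \<in> N" for y
    using has_derivative_diff[OF G'(1)[OF that] has_derivative_ident]
    by (simp add: \<psi>_def[abs_def] A_def minus_blinfun.rep_eq)
  have P\<psi>: "P (\<psi> y) = 0" if "y \<in> N" for y
    using PG[OF that] by (simp add: \<psi>_def blinfun.diff_right)
  \<comment> \<open>Differentiate the identity \<open>P (\<psi> y) = 0\<close>. It holds on the open
    set \<open>N\<close>, not merely on \<open>V\<close>, so the derivative is controlled in all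
    directions.\<close>
  have PA: "P (A y h) = 0" if "y \<in> N" for y h
  proof -
    have "((\<lambda>y. P (\<psi> y)) has_derivative (\<lambda>h. P (A y h))) (at y)"
      by (rule bounded_linear.has_derivative[OF blinfun.bounded_linear_right A[OF that]])
    then have "((\<lambda>y. 0) has_derivative (\<lambda>h. P (A y h))) (at y)"
      by (rule has_derivative_transform_within_open) (use N that P\<psi> in auto)
    from has_derivative_unique[OF this has_derivative_const] show ?thesis by meson
  qed
  have AEs: "A y h \<in> Es" if "y \<in> N" for y h using PA[OF that] P'(3) by simp
  \<comment> \<open>The derivative of \<open>G\<close> is the identity plus \<open>A y\<close>, so
    the image of \<open>M x0\<close> under it is a graph.\<close>
  have graph: "M (y + \<psi> y) = {e + A y e | e. e \<in> M x0}" if "y \<in> V" for y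
  proof -
    have "M (y + \<psi> y) = blinfun_apply (G' y) ` M x0"
      using GS[of y] S(4)[of "G y"] that by (simp add: V_def \<psi>_def)
    then show ?thesis by (auto simp: A_def blinfun.diff_left)
  qed
  have tdy: "top_direct_sum (M (y + \<psi> y)) Es" if "y \<in> V" for y
    unfolding graph[OF that] using that AEs by (intro top_direct_sum_graph[OF td]) (auto simp: V_def)
  \<comment> \<open>Uniqueness of the graph operator identifies it with the restricted derivative of
    \<open>\<psi>\<close>. This is the differential equation in (iii).\<close>
  have op: "graph_operator M (M x0) Es (y + \<psi> y) = restrict (A y) (M x0)" if "y \<in> V" for y
  proof (rule graph_operator_eqI[of "M x0" Es M, OF td tdy[OF that]])
    show "restrict (A y) (M x0) \<in> operators (M x0) Es"
      using that AEs by (intro restrict_blinfun_operators[OF X]) (auto simp: V_def)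
    show "M (y + \<psi> y) = {e + restrict (A y) (M x0) e | e. e \<in> M x0}"
      unfolding graph[OF that] by force
  qed
  have cA: "continuous_on V A"
    unfolding A_def using G'(2) by (auto simp: V_def intro!: continuous_intros elim: continuous_on_subset)
  have cont: "operator_continuous_on (M x0) V (\<lambda>x. graph_operator M (M x0) Es (x + \<psi> x))"
    by (rule operator_continuous_on_restrict[OF cA X op])
  have der: "has_derivative_between (M x0) Es V \<psi> (graph_operator M (M x0) Es (x + \<psi> x)) x" if "x \<in> V" for x
    unfolding op[OF that]
    by (rule has_derivative_between_restrict[OF A]) (use that AEs X in \<open>auto simp: V_def\<close>)
  show "\<exists>Es V \<psi>.
       top_direct_sum (M x0) Es \<and>
       openin (top_of_set (M x0)) V \<and> proj_along (M x0) Es x0 \<in> V \<and>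
       C1_between (M x0) Es V \<psi> \<and>
       (\<forall>x\<in>V. x + \<psi> x \<in> cofinal_set \<Lambda> M Es) \<and>
       operator_continuous_on (M x0) V (\<lambda>x. graph_operator M (M x0) Es (x + \<psi> x)) \<and>
       (\<forall>x\<in>V. has_derivative_between (M x0) Es V \<psi>
                 (graph_operator M (M x0) Es (x + \<psi> x)) x) \<and>
       \<psi> (proj_along (M x0) Es x0) = proj_along Es (M x0) x0"
  proof (rule exI[of _ Es], rule exI[of _ V], rule exI[of _ \<psi>], intro conjI ballI td cont der)
    show "openin (top_of_set (M x0)) V" using N(1) by (simp add: V_def openin_open_Int)
    show "proj_along (M x0) Es x0 \<in> V" using N(2) P'(1) by (simp add: V_def P)
    show "C1_between (M x0) Es V \<psi>"
      unfolding C1_between_def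
    proof (rule conjI)
      show "\<psi> \<in> V \<rightarrow> Es" using P\<psi> P'(3) by (auto simp: V_def)
    \<comment> \<open>By \<open>der\<close> and \<open>cont\<close> the graph operator itself serves
      as the continuous derivative.\<close>
    qed (intro exI[of _ "\<lambda>x. graph_operator M (M x0) Es (x + \<psi> x)"] conjI ballI cont der)
    show "x + \<psi> x \<in> cofinal_set \<Lambda> M Es" if "x \<in> V" for x
      using tdy[OF that] GS[of x] S(3) that by (auto simp: cofinal_set_def \<psi>_def V_def)
    show "\<psi> (proj_along (M x0) Es x0) = proj_along Es (M x0) x0" by (simp add: P P'(4) \<psi>_def Gx0)
  qed
next
  assume "\<exists>Es V \<psi>.
       top_direct_sum (M x0) Es \<and>
       openin (top_of_set (M x0)) V \<and> proj_along (M x0) Es x0 \<in> V \<and>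
       C1_between (M x0) Es V \<psi> \<and>
       (\<forall>x\<in>V. x + \<psi> x \<in> cofinal_set \<Lambda> M Es) \<and>
       operator_continuous_on (M x0) V (\<lambda>x. graph_operator M (M x0) Es (x + \<psi> x)) \<and>
       (\<forall>x\<in>V. has_derivative_between (M x0) Es V \<psi>
                 (graph_operator M (M x0) Es (x + \<psi> x)) x) \<and>
       \<psi> (proj_along (M x0) Es x0) = proj_along Es (M x0) x0"
  then show "C1_integrable_at \<Lambda> M x0" 
    by (elim exE conjE)
       (rule C1_integrable_atI, assumption+, erule (1) bspec, assumption, erule (1) bspec, assumption)
qed

end
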